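(* Let $p,q\in[1,\infty]$ be dual exponents ($1/p+1/q=1$, with $1/\infty=0$) and let $\phi=\|\cdot\|_p$ be the $\ell_p$-norm on $\mathbb{R}^n$. Then, for any $X\in\mathbb{S}^n$ with eigendecomposition $X=Q\Lambda(X)Q^\top$ ($Q$ orthogonal, $\Lambda(X)=\operatorname{diag}(\lambda(X))$), the optimal value of the spectral-gauge separation problem is $$g_\phi(X):=\min_{S\in\mathbb{S}^n_+,\ \|\lambda(S)\|_p\le 1}\langle S,X\rangle=-\|\lambda_-(X)\|_q,$$ with an optimal solution of the form $S^\star=Q\operatorname{diag}(z^\star)Q^\top$ for some $z^\star\in\operatorname{argmax}_{z\in\mathbb{R}^n_+}\{\lambda_-(X)^\top z:\ \|z\|_p\le 1\}$. In particular, if $1<p<\infty$ and $X\in\mathbb{S}^n\setminus\mathbb{S}^n_+$, then a maximizer $z^\star$ is defined componentwise by $$z^\star_i=\left(\frac{\lambda_-(X)_i}{\|\lambda_-(X)\|_q}\right)^{q-1}\quad\text{for all } i\in\{1,\dots,n\}.$$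
   Context: $\mathbb{S}^n$ is the space of real symmetric $n\times n$ matrices with the Frobenius inner product $\langle A,B\rangle=\operatorname{tr}(A^\top B)$; $\mathbb{S}^n_+$ is the cone of positive semidefinite matrices. For $X\in\mathbb{S}^n$, $\lambda(X)\in\mathbb{R}^n$ is the vector of eigenvalues in nondecreasing order, repeated with multiplicity, and $\lambda_-(X):=(\max\{-\lambda_i(X),0\})_{i}\in\mathbb{R}^n_+$. *)

theory Defs
  imports
    "Jordan_Normal_Form.Char_Poly"
    "HOL-Library.Extended_Real"
begin

definition sym_mats :: "nat \<Rightarrow> real mat set" where
  "sym_mats n = {A \<in> carrier_mat n n. transpose_mat A = A}"

definition psd_mats :: "nat \<Rightarrow> real mat set" where
  "psd_mats n = {A \<in> sym_mats n. \<forall>v \<in> carrier_vec n. 0 \<le> v \<bullet> (A *\<^sub>v v)}"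

definition mat_trace :: "real mat \<Rightarrow> real" where
  "mat_trace A = (\<Sum>i<dim_row A. A $$ (i, i))"

definition frob_inner :: "real mat \<Rightarrow> real mat \<Rightarrow> real" where
  "frob_inner A B = mat_trace (transpose_mat A * B)"

text \<open>Real orthogonal matrices. The library constant \<^const>\<open>orthogonal_mat\<close> is not
  suitable: it does not ask for columns of unit length.\<close>
definition orth_mats :: "nat \<Rightarrow> real mat set" where
  "orth_mats n = {Q \<in> carrier_mat n n. transpose_mat Q * Q = 1\<^sub>m n}"

text \<open>Eigenvalues in nondecreasing order, repeated with multiplicity: the sorted list of the
  real roots of the characteristic polynomial. A real symmetric matrix of order n has exactly
  n of them (multiplicity as a root and dimension of the eigenspace agree), so on
  \<open>sym_mats n\<close> this is a vector of dimension n.\<close>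
definition eig_vec :: "real mat \<Rightarrow> real vec" where
  "eig_vec A = vec_of_list (sorted_list_of_multiset (proots (char_poly A)))"

definition eig_neg :: "real mat \<Rightarrow> real vec" where
  "eig_neg A = map_vec (\<lambda>x. max (- x) 0) (eig_vec A)"

definition diag_of_vec :: "real vec \<Rightarrow> real mat" where
  "diag_of_vec v = mat_diag (dim_vec v) (\<lambda>i. v $ i)"

text \<open>The \<open>\<ell>\<^sub>p\<close>-norm for an extended exponent \<open>p \<in> [1, \<infinity>]\<close>. The element 0 is inserted
  under the maximum only to cover vectors of dimension 0.\<close>
definition lp_norm :: "ereal \<Rightarrow> real vec \<Rightarrow> real" where
  "lp_norm p x =
     (if p = \<infinity> then Max (insert 0 ((\<lambda>i. \<bar>x $ i\<bar>) ` {..<dim_vec x}))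
      else (\<Sum>i<dim_vec x. \<bar>x $ i\<bar> powr real_of_ereal p) powr (1 / real_of_ereal p))"

definition sep_feasible :: "(real vec \<Rightarrow> real) \<Rightarrow> nat \<Rightarrow> real mat \<Rightarrow> bool" where
  "sep_feasible \<phi> n S \<longleftrightarrow> S \<in> psd_mats n \<and> \<phi> (eig_vec S) \<le> 1"

definition sep_optimal :: "(real vec \<Rightarrow> real) \<Rightarrow> nat \<Rightarrow> real mat \<Rightarrow> real mat \<Rightarrow> bool" where
  "sep_optimal \<phi> n X S \<longleftrightarrow> is_arg_min (\<lambda>S. frob_inner S X) (sep_feasible \<phi> n) S"

text \<open>The optimal value, as an infimum; it is the minimum whenever some \<open>S\<close> satisfies
  \<open>sep_optimal \<phi> n X S\<close>.\<close>
definition sep_value :: "(real vec \<Rightarrow> real) \<Rightarrow> nat \<Rightarrow> real mat \<Rightarrow> real" where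
  "sep_value \<phi> n X = (INF S \<in> {S. sep_feasible \<phi> n S}. frob_inner S X)"

definition gauge_maximizer :: "(real vec \<Rightarrow> real) \<Rightarrow> nat \<Rightarrow> real mat \<Rightarrow> real vec \<Rightarrow> bool" where
  "gauge_maximizer \<phi> n X z \<longleftrightarrow>
     is_arg_max (\<lambda>z. eig_neg X \<bullet> z)
       (\<lambda>z. z \<in> carrier_vec n \<and> (\<forall>i<n. 0 \<le> z $ i) \<and> \<phi> z \<le> 1) z"

end

theory Submission
  imports Defs "Jordan_Normal_Form.Schur_Decomposition" "HOL-Analysis.Convex"
begin

text \<open>
  The upper bound on \<open>- \<langle>S, X\<rangle>\<close> is Hoelder's inequality, averaged over the overlaps of two
  eigenbases. Diagonalize \<open>X = Q diag(d) Q\<^sup>T\<close> and a feasible \<open>S = P diag(s) P\<^sup>T\<close>. Then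
  \<open>\<langle>S, X\<rangle> = \<Sum>\<^sub>i\<^sub>j D\<^sub>i\<^sub>j s\<^sub>i d\<^sub>j\<close>, where the entries \<open>D\<^sub>i\<^sub>j\<close> are the squared entries of the
  orthogonal matrix \<open>P\<^sup>T Q\<close>, so that \<open>D\<close> is doubly stochastic. As \<open>s \<ge> 0\<close> and
  \<open>d\<^sub>j \<ge> - max (- d\<^sub>j) 0\<close>, the sum is bounded below by minus the sum with the negative
  part of \<open>d\<close> in place of \<open>d\<close>, and Hoelder's inequality with the weights \<open>D\<^sub>i\<^sub>j\<close>
  (\<open>stochastic_Hoelder\<close>) applies. All rows and columns of \<open>D\<close> sum to 1, so the two factors are the
  unweighted norms of \<open>s\<close> and of the negative part of \<open>d\<close>.

  The bound is attained by a matrix with the same eigenvectors as \<open>X\<close>: then \<open>D\<close> is the identity,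
  and what is left is the equality case of Hoelder's inequality for vectors. Its solution \<open>z\<close> is
  required to vanish where the negative part vanishes (\<open>Hoelder_extremal\<close>), so that the
  positive eigenvalues of \<open>X\<close> do not contribute to \<open>\<langle>S, X\<rangle>\<close>. Such a \<open>z\<close> is written
  down for each pair of exponents: a unit vector, the indicator of the support, or the power formula.

  The argument is carried out for diagonalizations with eigenvalues in any order and transferred
  to \<open>eig_vec\<close> at the end, as \<open>lp_norm\<close> is determined by the multiset of entries. Diagonalizations
  exist by the spectral theorem for real symmetric matrices (\<open>sym_mats_spectral\<close>), which is
  proved here by extending an orthonormal family of eigenvectors one vector at a time.
\<close>

(* The infix bullet is to denote the scalar product of vectors only. *)
unbundle no inner_syntax

section \<open>The spectral theorem for real symmetric matrices\<close>

lemma mat_trace_mult_commute: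
  assumes "A \<in> carrier_mat n m" "B \<in> carrier_mat m n"
  shows "mat_trace (A * B) = mat_trace (B * A)"
proof -
  have "mat_trace (A * B) = (\<Sum>i<n. \<Sum>j<m. A $$ (i, j) * B $$ (j, i))"
    using assms by (auto simp: mat_trace_def scalar_prod_def atLeast0LessThan)
  also have "\<dots> = (\<Sum>j<m. \<Sum>i<n. B $$ (j, i) * A $$ (i, j))"
    by (subst sum.swap) (simp add: mult.commute)
  also have "\<dots> = mat_trace (B * A)"
    using assms by (auto simp: mat_trace_def scalar_prod_def atLeast0LessThan)
  finally show ?thesis .
qed

text \<open>The trace is invariant under similarity, and a matrix whose characteristic polynomial splits is
  similar to a triangular one with the roots on the diagonal.\<close>
lemma mat_trace_eq_sum_eigenvalues:
  assumes A: "A \<in> carrier_mat n n" and es: "char_poly A = (\<Prod>e\<leftarrow>es. [:- e, 1:])"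
  shows "mat_trace A = sum_list es"
proof -
  obtain B P Q where "schur_decomposition A es = (B, P, Q)"
    by (cases "schur_decomposition A es") auto
  from schur_decomposition[OF A es this]
  have wit: "similar_mat_wit A B P Q" and diag: "diag_mat B = es" by auto
  note c = similar_mat_witD2[OF A wit]
  have "mat_trace A = mat_trace (Q * (P * B))"
    unfolding c(3) using c by (intro mat_trace_mult_commute[of _ n n]) auto
  also have "Q * (P * B) = B"
    using c by (simp flip: assoc_mult_mat[of Q n n P n B n])
  also have "mat_trace B = sum_list (diag_mat B)"
    by (simp add: mat_trace_def diag_mat_def interv_sum_list_conv_sum_set_nat atLeast0LessThan)
  finally show ?thesis by (simp add: diag)
qed

lemma sym_mats_index:
  assumes "A \<in> sym_mats n" "i < n" "j < n"
  shows "A $$ (i, j) = A $$ (j, i)"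
proof -
  have "transpose_mat A $$ (i, j) = A $$ (j, i)"
    using assms by (intro index_transpose_mat) (auto simp: sym_mats_def)
  then show ?thesis using assms(1) by (simp add: sym_mats_def)
qed

lemma sym_mats_scalar_prod:
  assumes A: "A \<in> sym_mats n" and v: "v \<in> carrier_vec n" and w: "w \<in> carrier_vec n"
  shows "(A *\<^sub>v v) \<bullet> w = v \<bullet> (A *\<^sub>v w)"
  using transpose_vec_mult_scalar[of A n n w v] A v w by (auto simp: sym_mats_def)

text \<open>For an eigenvector \<open>v\<close>, the Hermitian form \<open>v\<^sup>* A v\<close> equals its own conjugate because \<open>A\<close> is
  real and symmetric; it also equals \<open>a\<close> times the squared length of \<open>v\<close>, which is a nonzero real.\<close>
lemma complex_eigenvalue_sym_mats_real:
  assumes A: "A \<in> sym_mats n" and ev: "eigenvalue (map_mat complex_of_real A) a"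
  shows "a \<in> \<real>"
proof -
  let ?A = "map_mat complex_of_real A"
  have Ac: "A \<in> carrier_mat n n" using A by (simp add: sym_mats_def)
  from ev obtain v where v: "v \<in> carrier_vec n" "v \<noteq> 0\<^sub>v n" and Av: "?A *\<^sub>v v = a \<cdot>\<^sub>v v"
    using Ac by (auto simp: eigenvalue_def eigenvector_def)
  define h where "h = (\<Sum>i<n. \<Sum>j<n. cnj (v $ i) * of_real (A $$ (i, j)) * v $ j)"
  define r where "r = (\<Sum>i<n. (cmod (v $ i))\<^sup>2)"
  have comp: "(\<Sum>j<n. of_real (A $$ (i, j)) * v $ j) = a * v $ i" if "i < n" for i
  proof -
    have "(?A *\<^sub>v v) $ i = (\<Sum>j<n. of_real (A $$ (i, j)) * v $ j)"
      using that Ac v by (auto simp: scalar_prod_def atLeast0LessThan)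
    then show ?thesis using Av that v by simp
  qed
  have "h = (\<Sum>i<n. cnj (v $ i) * (\<Sum>j<n. of_real (A $$ (i, j)) * v $ j))"
    by (simp add: h_def sum_distrib_left mult.assoc)
  also have "\<dots> = (\<Sum>i<n. a * (cnj (v $ i) * v $ i))"
    by (intro sum.cong refl) (simp add: comp)
  also have "\<dots> = a * of_real r"
    unfolding r_def of_real_sum sum_distrib_left
    by (intro sum.cong refl) (simp only: complex_norm_square mult_ac)
  finally have h: "h = a * of_real r" .
  have "cnj h = (\<Sum>i<n. \<Sum>j<n. v $ i * of_real (A $$ (j, i)) * cnj (v $ j))"
    unfolding h_def cnj_sum using sym_mats_index[OF A] by (intro sum.cong refl) simp
  also have "\<dots> = h"
    unfolding h_def by (subst sum.swap) (simp add: mult_ac)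
  finally have "h \<in> \<real>" by (simp add: Reals_cnj_iff)
  moreover have "r \<noteq> 0"
  proof
    assume "r = 0"
    then have "\<forall>i<n. v $ i = 0" by (simp add: r_def sum_nonneg_eq_0_iff)
    then show False using v by auto
  qed
  ultimately have "h / of_real r \<in> \<real>" by (intro Reals_divide) auto
  then show ?thesis using h \<open>r \<noteq> 0\<close> by simp
qed

lemma char_poly_sym_mats_splits:
  assumes A: "A \<in> sym_mats n"
  obtains es where "char_poly A = (\<Prod>e\<leftarrow>es. [:- e, 1:])" "length es = n"
proof -
  let ?A = "map_mat complex_of_real A"
  interpret h: map_poly_inj_comm_ring_hom complex_of_real
    by standard auto
  have Ac: "A \<in> carrier_mat n n" using A by (simp add: sym_mats_def)
  then have cA: "?A \<in> carrier_mat n n" by simp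
  from char_poly_factorized[OF cA] obtain as where
    as: "char_poly ?A = (\<Prod>a\<leftarrow>as. [:- a, 1:])" and len: "length as = n" by blast
  have "a \<in> \<real>" if "a \<in> set as" for a
  proof -
    have "poly (char_poly ?A) a = 0" 
      unfolding as poly_prod_list using that by (auto simp: prod_list_zero_iff)
    then show ?thesis 
      using complex_eigenvalue_sym_mats_real[OF A] eigenvalue_root_char_poly[OF cA] by blast
  qed
  then have map: "map (complex_of_real \<circ> Re) as = as"
    by (intro map_idI) auto
  have "map_poly complex_of_real (char_poly A) = char_poly ?A"
    by (rule of_real_hom.char_poly_hom[OF Ac, symmetric])
  also have "\<dots> = (\<Prod>a\<leftarrow>map (complex_of_real \<circ> Re) as. [:- a, 1:])" by (simp only: as map)
  also have "\<dots> = map_poly complex_of_real (\<Prod>e\<leftarrow>map Re as. [:- e, 1:])"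
    by (simp add: h.hom_prod_list o_def hom_distribs)
  finally have "char_poly A = (\<Prod>e\<leftarrow>map Re as. [:- e, 1:])"
    by (simp only: h.eq_iff)
  then show thesis using len that[of "map Re as"] by simp
qed

text \<open>The induction step of the spectral theorem. Adding \<open>(t - l\<^sub>i) u\<^sub>i u\<^sub>i\<^sup>T\<close> for each \<open>i < k\<close> moves the
  eigenvalues of all known eigenvectors to the single value \<open>t\<close> and leaves the matrix unchanged on
  their orthogonal complement. If the new matrix \<open>B\<close> has an eigenvalue \<open>e \<noteq> t\<close>, symmetry makes its
  eigenvector orthogonal to every \<open>u\<^sub>i\<close>, hence an eigenvector of \<open>A\<close> itself. This avoids passing
  to a matrix of smaller dimension on the complement.\<close>
lemma orthonormal_eigenvector_extension:
  fixes u :: "nat \<Rightarrow> real vec" and l :: "nat \<Rightarrow> real"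
  assumes A: "A \<in> sym_mats n" and k: "k < n"
    and u: "\<And>i. i < k \<Longrightarrow> u i \<in> carrier_vec n"
    and ev: "\<And>i. i < k \<Longrightarrow> A *\<^sub>v u i = l i \<cdot>\<^sub>v u i"
    and on: "\<And>i j. i < k \<Longrightarrow> j < k \<Longrightarrow> u i \<bullet> u j = (if i = j then 1 else 0)"
  obtains w e where "w \<in> carrier_vec n" "A *\<^sub>v w = e \<cdot>\<^sub>v w" "w \<bullet> w = 1"
    "\<And>i. i < k \<Longrightarrow> u i \<bullet> w = 0"
proof -
  have Ac: "A \<in> carrier_mat n n" using A by (simp add: sym_mats_def)
  have sp: "u i \<bullet> w = (\<Sum>b<n. u i $ b * w $ b)" if "w \<in> carrier_vec n" for i w
    using that by (simp add: scalar_prod_def atLeast0LessThan)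
  \<comment> \<open>If \<open>t\<close> were the only eigenvalue of \<open>B\<close>, then \<open>n t = tr B = tr A + k t - \<Sum>l\<^sub>i\<close>,
    which determines \<open>(n - k) t\<close>; the summand 1 makes \<open>t\<close> miss that value.\<close>
  define t where "t = (mat_trace A - (\<Sum>i<k. l i) + 1) / real (n - k)"
  define B where "B = A + mat n n (\<lambda>(a, b). \<Sum>i<k. (t - l i) * u i $ a * u i $ b)"
  have Bc: "B \<in> carrier_mat n n" using Ac by (simp add: B_def)
  have B: "B \<in> sym_mats n"
    using Bc sym_mats_index[OF A] Ac unfolding sym_mats_def
    by (auto simp: B_def mult_ac intro!: eq_matI)
  have Bmult: "(B *\<^sub>v w) $ a = (A *\<^sub>v w) $ a + (\<Sum>i<k. (t - l i) * (u i \<bullet> w) * u i $ a)"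
    if w: "w \<in> carrier_vec n" and a: "a < n" for w a
  proof -
    have "(B *\<^sub>v w) $ a = (\<Sum>b<n. (A $$ (a, b) + (\<Sum>i<k. (t - l i) * u i $ a * u i $ b)) * w $ b)"
      using w a Ac by (auto simp: B_def scalar_prod_def atLeast0LessThan)
    also have "\<dots> = (\<Sum>b<n. A $$ (a, b) * w $ b)
        + (\<Sum>b<n. \<Sum>i<k. (t - l i) * u i $ a * u i $ b * w $ b)"
      by (simp add: distrib_right sum.distrib sum_distrib_right)
    also have "(\<Sum>b<n. A $$ (a, b) * w $ b) = (A *\<^sub>v w) $ a"
      using w a Ac by (auto simp: scalar_prod_def atLeast0LessThan)
    also have "(\<Sum>b<n. \<Sum>i<k. (t - l i) * u i $ a * u i $ b * w $ b)
        = (\<Sum>i<k. (t - l i) * (u i \<bullet> w) * u i $ a)"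
      using w by (subst sum.swap) (simp add: sp sum_distrib_left sum_distrib_right mult_ac)
    finally show ?thesis .
  qed
  have Bu: "B *\<^sub>v u j = t \<cdot>\<^sub>v u j" if j: "j < k" for j
  proof (rule eq_vecI)
    fix a assume "a < dim_vec (t \<cdot>\<^sub>v u j)"
    then have a: "a < n" using u[OF j] by simp
    have "(\<Sum>i<k. (t - l i) * (u i \<bullet> u j) * u i $ a)
        = (\<Sum>i<k. if i = j then (t - l i) * u i $ a else 0)"
      using on j by (intro sum.cong) auto
    also have "\<dots> = (t - l j) * u j $ a" using j by simp
    finally show "(B *\<^sub>v u j) $ a = (t \<cdot>\<^sub>v u j) $ a"
      using Bmult[OF u[OF j] a] ev[OF j] a u[OF j] by (simp add: algebra_simps)
  qed (use Bc u[OF j] in auto)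
  obtain es where es: "char_poly B = (\<Prod>e\<leftarrow>es. [:- e, 1:])" and len: "length es = n"
    using char_poly_sym_mats_splits[OF B] .
  have "mat_trace B = mat_trace A + (\<Sum>i<k. (t - l i) * (u i \<bullet> u i))"
  proof -
    have "mat_trace B = (\<Sum>a<n. A $$ (a, a)) + (\<Sum>a<n. \<Sum>i<k. (t - l i) * u i $ a * u i $ a)"
      using Ac by (simp add: mat_trace_def B_def sum.distrib)
    also have "(\<Sum>a<n. \<Sum>i<k. (t - l i) * u i $ a * u i $ a) = (\<Sum>i<k. (t - l i) * (u i \<bullet> u i))"
      by (subst sum.swap) (simp add: sp u sum_distrib_left mult_ac)
    finally show ?thesis using Ac by (simp add: mat_trace_def)
  qed
  also have "(\<Sum>i<k. (t - l i) * (u i \<bullet> u i)) = real k * t - (\<Sum>i<k. l i)"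
    using on by (simp add: sum_subtractf)
  finally have tr: "mat_trace B = mat_trace A + real k * t - (\<Sum>i<k. l i)" by simp
  have "\<exists>e\<in>set es. e \<noteq> t"
  proof (rule ccontr)
    assume "\<not> ?thesis"
    then have "es = replicate n t" using len by (intro replicate_eqI) auto
    then have "real n * t = mat_trace A + real k * t - (\<Sum>i<k. l i)"
      using mat_trace_eq_sum_eigenvalues[OF Bc es] tr by (simp add: sum_list_replicate)
    moreover have "real (n - k) * t = mat_trace A - (\<Sum>i<k. l i) + 1"
      using k by (simp add: t_def)
    moreover have "real n * t = real (n - k) * t + real k * t"
      using k by (simp add: of_nat_diff algebra_simps)
    ultimately show False by linarith
  qed
  then obtain e where e: "e \<in> set es" "e \<noteq> t" by blast
  then have "poly (char_poly B) e = 0"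
    unfolding es poly_prod_list by (auto simp: prod_list_zero_iff)
  then obtain v where v: "v \<in> carrier_vec n" "v \<noteq> 0\<^sub>v n" "B *\<^sub>v v = e \<cdot>\<^sub>v v"
    using eigenvalue_root_char_poly[OF Bc] Bc by (auto simp: eigenvalue_def eigenvector_def)
  have orth: "u i \<bullet> v = 0" if i: "i < k" for i
  proof -
    have "(B *\<^sub>v u i) \<bullet> v = u i \<bullet> (B *\<^sub>v v)"
      using sym_mats_scalar_prod[OF B u[OF i] v(1)] .
    then have "t * (u i \<bullet> v) = e * (u i \<bullet> v)"
      using Bu[OF i] v u[OF i] by simp
    then show ?thesis using e by simp
  qed
  have Av: "A *\<^sub>v v = e \<cdot>\<^sub>v v"
  proof (rule eq_vecI)
    fix a assume "a < dim_vec (e \<cdot>\<^sub>v v)"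
    then have a: "a < n" using v by simp
    show "(A *\<^sub>v v) $ a = (e \<cdot>\<^sub>v v) $ a"
      using Bmult[OF v(1) a] v(3) orth by simp
  qed (use Ac v in auto)
  have pos: "v \<bullet> v > 0"
  proof -
    have "v \<bullet> v = (\<Sum>i<n. (v $ i)\<^sup>2)" 
      using v by (auto simp: scalar_prod_def atLeast0LessThan power2_eq_square)
    moreover have "\<exists>i<n. v $ i \<noteq> 0" using v by auto
    ultimately show ?thesis by (auto intro!: sum_pos2)
  qed
  define w where "w = (1 / sqrt (v \<bullet> v)) \<cdot>\<^sub>v v"
  show thesis
  proof (rule that[of w e])
    show "w \<in> carrier_vec n" using v by (simp add: w_def)
    show "A *\<^sub>v w = e \<cdot>\<^sub>v w"
      using v Ac Av by (simp add: w_def mult_mat_vec smult_smult_assoc mult.commute)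
    show "w \<bullet> w = 1"
      using v pos by (simp add: w_def)
    show "u i \<bullet> w = 0" if "i < k" for i
      using v orth[OF that] u[OF that] by (simp add: w_def)
  qed
qed

lemma orthonormal_eigenvectors:
  fixes A :: "real mat"
  assumes A: "A \<in> sym_mats n" and "k \<le> n"
  shows "\<exists>u l. \<forall>i<k. u i \<in> carrier_vec n \<and> A *\<^sub>v u i = l i \<cdot>\<^sub>v u i
    \<and> (\<forall>j<k. u i \<bullet> u j = (if i = j then 1 else 0))"
  using \<open>k \<le> n\<close>
proof (induction k)
  case (Suc k)
  then obtain u and l :: "nat \<Rightarrow> real" where ul: "\<forall>i<k. u i \<in> carrier_vec n \<and> A *\<^sub>v u i = l i \<cdot>\<^sub>v u i
    \<and> (\<forall>j<k. u i \<bullet> u j = (if i = j then 1 else 0))" by auto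
  obtain w e where w: "w \<in> carrier_vec n" "A *\<^sub>v w = e \<cdot>\<^sub>v w" "w \<bullet> w = 1"
    "\<And>i. i < k \<Longrightarrow> u i \<bullet> w = 0"
    by (rule orthonormal_eigenvector_extension[OF A, of k u l]) (use ul Suc.prems in auto)
  have w': "w \<bullet> u i = 0" if "i < k" for i
    using w ul that by (metis comm_scalar_prod)
  show ?case
    using ul w w'
    by (intro exI[of _ "u(k := w)"] exI[of _ "l(k := e)"]) (auto simp: less_Suc_eq)
qed auto

theorem sym_mats_spectral:
  assumes A: "A \<in> sym_mats n"
  obtains Q d where "Q \<in> orth_mats n" "d \<in> carrier_vec n"
    "A = Q * diag_of_vec d * transpose_mat Q"
proof -
  from orthonormal_eigenvectors[OF A order_refl] obtain u l where
    u: "\<And>i. i < n \<Longrightarrow> u i \<in> carrier_vec n" and ev: "\<And>i. i < n \<Longrightarrow> A *\<^sub>v u i = l i \<cdot>\<^sub>v u i"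
    and on: "\<And>i j. i < n \<Longrightarrow> j < n \<Longrightarrow> u i \<bullet> u j = (if i = j then 1 else 0)" by blast
  have Ac: "A \<in> carrier_mat n n" using A by (simp add: sym_mats_def)
  define Q where "Q = mat n n (\<lambda>(i, j). u j $ i)"
  have Qc: "Q \<in> carrier_mat n n" by (simp add: Q_def)
  have col: "col Q j = u j" if "j < n" for j
    using u[OF that] that by (intro eq_vecI) (auto simp: Q_def)
  have QQ: "transpose_mat Q * Q = 1\<^sub>m n"
    using Qc on by (intro eq_matI) (auto simp: col)
  then have QQ': "Q * transpose_mat Q = 1\<^sub>m n"
    using mat_mult_left_right_inverse[of "transpose_mat Q" n Q] Qc by simp
  let ?D = "diag_of_vec (vec n l)"
  have Dc: "?D \<in> carrier_mat n n" by (simp add: diag_of_vec_def)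
  have "A * Q = Q * ?D"
  proof (rule eq_matI)
    fix i j assume "i < dim_row (Q * ?D)" "j < dim_col (Q * ?D)"
    then have ij: "i < n" "j < n" using Qc Dc by auto
    have "(A * Q) $$ (i, j) = (A *\<^sub>v u j) $ i" using ij Ac Qc by (simp add: col)
    also have "\<dots> = u j $ i * l j" using ev[OF ij(2)] u[OF ij(2)] ij by simp
    also have "\<dots> = (Q * ?D) $$ (i, j)"
      using ij unfolding diag_of_vec_def by (simp add: mat_diag_mult_right[OF Qc]) (simp add: Q_def)
    finally show "(A * Q) $$ (i, j) = (Q * ?D) $$ (i, j)" .
  qed (use Ac Qc Dc in auto)
  then have "Q * ?D * transpose_mat Q = A * (Q * transpose_mat Q)"
    using Ac Qc by (metis assoc_mult_mat transpose_carrier_mat)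
  then have "A = Q * ?D * transpose_mat Q" using QQ' Ac by simp
  then show thesis using that[of Q "vec n l"] Qc QQ by (simp add: orth_mats_def)
qed

section \<open>Eigenvalues, definiteness and inner products of diagonalized matrices\<close>

lemma orth_matsD:
  assumes "Q \<in> orth_mats n"
  shows "Q \<in> carrier_mat n n" "transpose_mat Q * Q = 1\<^sub>m n" "Q * transpose_mat Q = 1\<^sub>m n"
  using assms mat_mult_left_right_inverse[of "transpose_mat Q" n Q] by (auto simp: orth_mats_def)

lemma diag_of_vec_carrier [simp]: "d \<in> carrier_vec n \<Longrightarrow> diag_of_vec d \<in> carrier_mat n n"
  by (auto simp: diag_of_vec_def)

lemma mset_eig_vec: "mset (list_of_vec (eig_vec A)) = proots (char_poly A)"
  by (simp add: eig_vec_def list_vec)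

lemma proots_prod_linear: "proots (\<Prod>e\<leftarrow>es. [:- e, 1:]) = mset (es :: real list)"
proof (induction es)
  case (Cons e es)
  have "(\<Prod>e\<leftarrow>es. [:- e, 1:]) \<noteq> 0" by (auto simp: prod_list_zero_iff)
  then have "proots ([:- e, 1:] * (\<Prod>e\<leftarrow>es. [:- e, 1:])) = mset (e # es)"
    by (subst proots_mult) (auto simp: Cons.IH)
  then show ?case by simp
qed simp

lemma mset_eig_vec_diagonalized:
  assumes Q: "Q \<in> orth_mats n" and d: "d \<in> carrier_vec n"
  shows "mset (list_of_vec (eig_vec (Q * diag_of_vec d * transpose_mat Q))) = mset (list_of_vec d)"
proof -
  note Q = orth_matsD[OF Q]
  let ?D = "diag_of_vec d"
  have D: "?D \<in> carrier_mat n n" "upper_triangular ?D"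
    using d by (auto simp: diag_of_vec_def mat_diag_def)
  have "similar_mat (Q * ?D * transpose_mat Q) ?D"
    using Q d by (intro similar_matI[of _ _ Q "transpose_mat Q" n]) auto
  then have "char_poly (Q * ?D * transpose_mat Q) = char_poly ?D" by (rule char_poly_similar)
  also have "\<dots> = (\<Prod>e\<leftarrow>diag_mat ?D. [:- e, 1:])" by (rule char_poly_upper_triangular[OF D])
  also have "diag_mat ?D = list_of_vec d"
    using d by (intro nth_equalityI) (auto simp: diag_mat_def diag_of_vec_def mat_diag_def list_of_vec_index)
  finally show ?thesis by (simp add: mset_eig_vec proots_prod_linear)
qed

text \<open>Permutation invariance of the norm. It is what allows the sorted vector of eigenvalues to be
  replaced by the diagonal of an arbitrary diagonalization.\<close>
lemma lp_norm_cong_mset: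
  assumes "mset (list_of_vec x) = mset (list_of_vec y)"
  shows "lp_norm p x = lp_norm p y"
proof -
  have sum: "(\<Sum>i<dim_vec v. f (v $ i)) = sum_mset (image_mset f (mset (list_of_vec v)))"
    for v and f :: "real \<Rightarrow> real"
  proof -
    have "(\<Sum>i<dim_vec v. f (v $ i)) = sum_list (map f (list_of_vec v))"
      by (simp add: sum_list_sum_nth atLeast0LessThan list_of_vec_index)
    then show ?thesis by (simp flip: sum_mset_sum_list)
  qed
  have set: "(\<lambda>i. \<bar>v $ i\<bar>) ` {..<dim_vec v} = abs ` set_mset (mset (list_of_vec v))" for v :: "real vec"
    by (auto simp: set_conv_nth list_of_vec_index image_iff)
  show ?thesis
    unfolding lp_norm_def set sum[where f = "\<lambda>x. \<bar>x\<bar> powr real_of_ereal p"] assms ..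
qed

lemma dim_vec_cong_mset:
  "mset (list_of_vec x) = mset (list_of_vec y) \<Longrightarrow> dim_vec x = dim_vec y"
  by (metis length_list_of_vec size_mset)

lemma diag_of_vec_mult_vec:
  assumes "d \<in> carrier_vec n" "w \<in> carrier_vec n" "i < n"
  shows "(diag_of_vec d *\<^sub>v w) $ i = d $ i * w $ i"
proof -
  have "(diag_of_vec d *\<^sub>v w) $ i = (\<Sum>j<n. (if i = j then d $ j else 0) * w $ j)"
    using assms by (auto simp: diag_of_vec_def mat_diag_def scalar_prod_def atLeast0LessThan)
  also have "\<dots> = (\<Sum>j<n. if j = i then d $ i * w $ i else 0)"
    by (intro sum.cong) auto
  finally show ?thesis using assms by simp
qed

text \<open>In eigenbasis coordinates a quadratic form is a weighted sum of squares, so that definiteness can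
  be read off the diagonal.\<close>
lemma quadratic_form_diagonalized:
  fixes v :: "real vec"
  assumes Q: "Q \<in> orth_mats n" and d: "d \<in> carrier_vec n" and v: "v \<in> carrier_vec n"
  shows "v \<bullet> ((Q * diag_of_vec d * transpose_mat Q) *\<^sub>v v)
    = (\<Sum>i<n. d $ i * ((transpose_mat Q *\<^sub>v v) $ i)\<^sup>2)"
proof -
  note Q = orth_matsD[OF Q]
  let ?w = "transpose_mat Q *\<^sub>v v"
  have w: "?w \<in> carrier_vec n" using Q v by auto
  have Dw: "diag_of_vec d *\<^sub>v ?w \<in> carrier_vec n" using mult_mat_vec_carrier[OF diag_of_vec_carrier[OF d] w] .
  have "(Q * diag_of_vec d * transpose_mat Q) *\<^sub>v v = Q *\<^sub>v (diag_of_vec d *\<^sub>v ?w)"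
    using Q d v w by (simp add: assoc_mult_mat_vec[of _ n n _ n])
  then have "v \<bullet> ((Q * diag_of_vec d * transpose_mat Q) *\<^sub>v v) = ?w \<bullet> (diag_of_vec d *\<^sub>v ?w)"
    using transpose_vec_mult_scalar[OF Q(1) Dw v] by simp
  also have "\<dots> = (\<Sum>i<n. d $ i * (?w $ i)\<^sup>2)"
    by (simp add: scalar_prod_def atLeast0LessThan diag_of_vec_mult_vec[OF d w]
        carrier_matD(1)[OF diag_of_vec_carrier[OF d]] power2_eq_square mult_ac del: index_mult_mat_vec)
  finally show ?thesis .
qed

lemma diagonalized_sym_mats:
  assumes P: "P \<in> carrier_mat n n" and s: "s \<in> carrier_vec n"
  shows "P * diag_of_vec s * transpose_mat P \<in> sym_mats n"
proof -
  let ?S = "diag_of_vec s"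
  have S: "?S \<in> carrier_mat n n" "transpose_mat ?S = ?S"
    using s by (auto simp: diag_of_vec_def mat_diag_def)
  have "transpose_mat (P * ?S * transpose_mat P) = P * ?S * transpose_mat P"
    using P S by (simp add: transpose_mult[of _ n n _ n] assoc_mult_mat[of _ n n _ n _ n])
  then show ?thesis using P S by (auto simp: sym_mats_def)
qed

lemma psd_diagonalized_iff:
  assumes Q: "Q \<in> orth_mats n" and d: "d \<in> carrier_vec n"
  shows "Q * diag_of_vec d * transpose_mat Q \<in> psd_mats n \<longleftrightarrow> (\<forall>i<n. 0 \<le> d $ i)"
    (is "?A \<in> _ \<longleftrightarrow> _")
proof
  note QD = orth_matsD[OF Q]
  show "\<forall>i<n. 0 \<le> d $ i" if psd: "?A \<in> psd_mats n"
  proof (intro allI impI)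
    fix i assume i: "i < n"
    \<comment> \<open>Testing the form on the \<open>i\<close>-th eigenvector isolates \<open>d\<^sub>i\<close>.\<close>
    have c: "col Q i \<in> carrier_vec n" using QD i by auto
    have "(transpose_mat Q *\<^sub>v col Q i) $ j = (if j = i then 1 else 0)" if j: "j < n" for j
    proof -
      have "(transpose_mat Q *\<^sub>v col Q i) $ j = (transpose_mat Q * Q) $$ (j, i)"
        using i j QD(1) by simp
      then show ?thesis using i j QD(2) by simp
    qed
    then have "(\<Sum>j<n. d $ j * ((transpose_mat Q *\<^sub>v col Q i) $ j)\<^sup>2) = (\<Sum>j<n. if j = i then d $ j else 0)"
      by (intro sum.cong) auto
    moreover have "0 \<le> col Q i \<bullet> (?A *\<^sub>v col Q i)" using psd c by (simp add: psd_mats_def)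
    ultimately show "0 \<le> d $ i"
      using quadratic_form_diagonalized[OF Q d c] i by simp
  qed
  show "?A \<in> psd_mats n" if nonneg: "\<forall>i<n. 0 \<le> d $ i"
  proof -
    have "?A \<in> sym_mats n" by (rule diagonalized_sym_mats[OF QD(1) d])
    then show ?thesis
      using nonneg by (auto simp: psd_mats_def quadratic_form_diagonalized[OF Q d] intro!: sum_nonneg)
  qed
qed

text \<open>The trace is cyclic, so only the change of basis \<open>M = P\<^sup>T Q\<close> between the two eigenbases
  enters, and it enters through its squared entries.\<close>
lemma frob_inner_diagonalized:
  assumes P: "P \<in> orth_mats n" and s: "s \<in> carrier_vec n"
    and Q: "Q \<in> orth_mats n" and d: "d \<in> carrier_vec n"
  shows "frob_inner (P * diag_of_vec s * transpose_mat P) (Q * diag_of_vec d * transpose_mat Q)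
    = (\<Sum>i<n. \<Sum>j<n. ((transpose_mat P * Q) $$ (i, j))\<^sup>2 * (s $ i * d $ j))"
proof -
  note P = orth_matsD[OF P] note Q = orth_matsD[OF Q]
  define M where "M = transpose_mat P * Q"
  have M: "M \<in> carrier_mat n n" using P Q by (auto simp: M_def)
  let ?S = "diag_of_vec s" let ?D = "diag_of_vec d"
  have SD: "?S \<in> carrier_mat n n" "?D \<in> carrier_mat n n" using s d by auto
  have MT: "transpose_mat M = transpose_mat Q * P"
    using P Q by (simp add: M_def transpose_mult[of _ n n _ n])
  have "transpose_mat (P * ?S * transpose_mat P) = P * ?S * transpose_mat P"
    using diagonalized_sym_mats[OF P(1) s] by (simp add: sym_mats_def)
  then have "frob_inner (P * ?S * transpose_mat P) (Q * ?D * transpose_mat Q)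
      = mat_trace ((P * ?S * transpose_mat P * (Q * ?D)) * transpose_mat Q)"
    using P Q SD by (simp add: frob_inner_def assoc_mult_mat[of _ n n _ n _ n])
  also have "\<dots> = mat_trace (transpose_mat Q * (P * ?S * transpose_mat P * (Q * ?D)))"
    using P Q SD by (intro mat_trace_mult_commute[of _ n n]) auto
  also have "transpose_mat Q * (P * ?S * transpose_mat P * (Q * ?D))
      = (transpose_mat M * ?S) * (M * ?D)"
    unfolding MT using P Q SD by (simp add: M_def assoc_mult_mat[of _ n n _ n _ n])
  also have "transpose_mat M * ?S = mat n n (\<lambda>(j, i). M $$ (i, j) * s $ i)"
    using M s unfolding diag_of_vec_def
    by (subst mat_diag_mult_right[of _ n]) (auto intro!: eq_matI)
  also have "M * ?D = mat n n (\<lambda>(i, j). M $$ (i, j) * d $ j)"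
    using M d unfolding diag_of_vec_def
    by (subst mat_diag_mult_right[of _ n]) auto
  also have "mat_trace (mat n n (\<lambda>(j, i). M $$ (i, j) * s $ i) * mat n n (\<lambda>(i, j). M $$ (i, j) * d $ j))
      = (\<Sum>j<n. \<Sum>i<n. (M $$ (i, j) * s $ i) * (M $$ (i, j) * d $ j))"
    by (simp add: mat_trace_def scalar_prod_def atLeast0LessThan)
  also have "\<dots> = (\<Sum>i<n. \<Sum>j<n. (M $$ (i, j))\<^sup>2 * (s $ i * d $ j))"
    by (subst sum.swap) (simp add: power2_eq_square mult_ac)
  finally show ?thesis by (simp add: M_def)
qed

lemma orth_mats_squares_stochastic:
  assumes Q: "Q \<in> orth_mats n"
  shows "j < n \<Longrightarrow> (\<Sum>i<n. (Q $$ (i, j))\<^sup>2) = 1" "i < n \<Longrightarrow> (\<Sum>j<n. (Q $$ (i, j))\<^sup>2) = 1"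
proof -
  note Q = orth_matsD[OF Q]
  assume j: "j < n"
  have "(\<Sum>i<n. (Q $$ (i, j))\<^sup>2) = (transpose_mat Q * Q) $$ (j, j)"
    using j Q(1) by (simp add: scalar_prod_def atLeast0LessThan power2_eq_square)
  then show "(\<Sum>i<n. (Q $$ (i, j))\<^sup>2) = 1" using Q(2) j by simp
next
  note Q = orth_matsD[OF Q]
  assume i: "i < n"
  have "(\<Sum>j<n. (Q $$ (i, j))\<^sup>2) = (Q * transpose_mat Q) $$ (i, i)"
    using i Q(1) by (simp add: scalar_prod_def atLeast0LessThan power2_eq_square)
  then show "(\<Sum>j<n. (Q $$ (i, j))\<^sup>2) = 1" using Q(3) i by simp
qed

lemma orth_mats_transpose_mult:
  assumes "P \<in> orth_mats n" "Q \<in> orth_mats n"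
  shows "transpose_mat P * Q \<in> orth_mats n"
proof -
  note P = orth_matsD[OF assms(1)] note Q = orth_matsD[OF assms(2)]
  have "transpose_mat (transpose_mat P * Q) * (transpose_mat P * Q)
      = transpose_mat Q * ((P * transpose_mat P) * Q)"
    using P(1) Q(1) by (simp add: transpose_mult[of _ n n _ n] assoc_mult_mat[of _ n n _ n _ n])
  then show ?thesis using P Q by (simp add: orth_mats_def)
qed

section \<open>Hoelder's inequality with doubly stochastic weights\<close>

lemma dual_exponents_cases:
  fixes p q :: ereal
  assumes "1 \<le> p" "1 \<le> q" "1 / p + 1 / q = 1"
  obtains (one_inf) "p = 1" "q = \<infinity>" | (inf_one) "p = \<infinity>" "q = 1"
    | (real) a b :: real where "p = ereal a" "q = ereal b" "1 < a" "1 < b" "1 / a + 1 / b = 1"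
proof (cases p)
  case (real a)
  then have a: "1 \<le> a" using assms(1) by simp
  show thesis
  proof (cases q)
    case (real b)
    then have b: "1 \<le> b" using assms(2) by simp
    have 1: "1 / a + 1 / b = 1"
      using assms(3) a b unfolding \<open>p = ereal a\<close> \<open>q = ereal b\<close> one_ereal_def by simp
    then have "1 / a < 1" "1 / b < 1" using a b by (smt (verit) divide_pos_pos)+
    then have "1 < a" "1 < b" using a b by (simp_all add: divide_simps split: if_splits)
    then show thesis using that(3) 1 \<open>p = ereal a\<close> \<open>q = ereal b\<close> by blast
  next
    case PInf
    then have "1 / a = 1" using assms(3) a unfolding \<open>p = ereal a\<close> one_ereal_def by simp
    then show thesis using that(1) PInf \<open>p = ereal a\<close> a by (simp add: one_ereal_def)
  qed (use assms in auto)
next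
  case PInf
  show thesis
  proof (cases q)
    case (real b)
    then have b: "1 \<le> b" using assms(2) by simp
    then have "1 / b = 1" using assms(3) PInf unfolding \<open>q = ereal b\<close> one_ereal_def by simp
    then show thesis using that(2) PInf \<open>q = ereal b\<close> b by (simp add: one_ereal_def)
  qed (use assms PInf in auto)
qed (use assms in auto)

lemma lp_norm_ereal: "lp_norm (ereal a) x = (\<Sum>i<dim_vec x. \<bar>x $ i\<bar> powr a) powr (1 / a)"
  by (simp add: lp_norm_def)

lemma lp_norm_one: "lp_norm 1 x = (\<Sum>i<dim_vec x. \<bar>x $ i\<bar>)"
  by (simp add: one_ereal_def lp_norm_ereal sum_nonneg)

lemma lp_norm_infinity_upper: "i < dim_vec x \<Longrightarrow> \<bar>x $ i\<bar> \<le> lp_norm \<infinity> x"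
  by (auto simp: lp_norm_def intro!: Max_ge)

lemma lp_norm_nonneg: "0 \<le> lp_norm p x"
  by (auto simp: lp_norm_def intro!: Max_ge)

lemma lp_norm_powr:
  assumes "a > 0"
  shows "lp_norm (ereal a) x powr a = (\<Sum>i<dim_vec x. \<bar>x $ i\<bar> powr a)"
  using assms by (simp add: lp_norm_ereal powr_powr sum_nonneg)

lemma lp_norm_zero: 
  assumes "\<And>i. i < dim_vec x \<Longrightarrow> x $ i = 0"
  shows "lp_norm p x = 0"
proof (cases "p = \<infinity>")
  case True
  have "insert 0 ((\<lambda>i. \<bar>x $ i\<bar>) ` {..<dim_vec x}) = {0}" using assms by auto
  then show ?thesis using True by (simp only: lp_norm_def Max_singleton simp_thms if_True)
qed (use assms in \<open>simp add: lp_norm_def\<close>)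

lemma lp_norm_pos:
  assumes "1 < a" "i < dim_vec x" "x $ i \<noteq> 0"
  shows "0 < lp_norm (ereal a) x"
proof -
  have "0 < (\<Sum>i<dim_vec x. \<bar>x $ i\<bar> powr a)" using assms by (auto intro!: sum_pos2[of _ i])
  then show ?thesis by (simp add: lp_norm_ereal)
qed

text \<open>Each entry of \<open>t\<close> is at most the maximum,
  and the weights in row \<open>i\<close> then add up to 1.\<close>
lemma stochastic_Hoelder_one_infinity:
  assumes D: "\<And>i j. i < n \<Longrightarrow> j < n \<Longrightarrow> 0 \<le> D i j" and row: "\<And>i. i < n \<Longrightarrow> (\<Sum>j<n. D i j) = 1"
    and s: "s \<in> carrier_vec n" "\<And>i. i < n \<Longrightarrow> 0 \<le> s $ i" and t: "t \<in> carrier_vec n"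
  shows "(\<Sum>i<n. \<Sum>j<n. D i j * (s $ i * t $ j)) \<le> lp_norm 1 s * lp_norm \<infinity> t"
proof -
  have "(\<Sum>i<n. \<Sum>j<n. D i j * (s $ i * t $ j)) \<le> (\<Sum>i<n. \<Sum>j<n. D i j * (s $ i * lp_norm \<infinity> t))"
    using D s t lp_norm_infinity_upper[of _ t] by (intro sum_mono mult_left_mono) (auto simp: abs_le_iff)
  also have "\<dots> = (\<Sum>i<n. s $ i * lp_norm \<infinity> t)"
    using row by (simp flip: sum_distrib_right)
  also have "\<dots> = lp_norm 1 s * lp_norm \<infinity> t"
    using s by (simp add: lp_norm_one sum_distrib_right)
  finally show ?thesis .
qed

text \<open>For finite exponents, normalize both vectors and apply Young's inequality to each product. The
  sum splits into a part depending on \<open>i\<close> only and a part depending on \<open>j\<close> only. Unit row sums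
  collapse the first to \<open>1/a\<close>, unit column sums collapse the second to \<open>1/b\<close>, and these add up
  to 1.\<close>
lemma stochastic_Hoelder:
  fixes p q :: ereal and D :: "nat \<Rightarrow> nat \<Rightarrow> real"
  assumes dual: "1 \<le> p" "1 \<le> q" "1 / p + 1 / q = 1"
    and D: "\<And>i j. i < n \<Longrightarrow> j < n \<Longrightarrow> 0 \<le> D i j"
    and row: "\<And>i. i < n \<Longrightarrow> (\<Sum>j<n. D i j) = 1" and col: "\<And>j. j < n \<Longrightarrow> (\<Sum>i<n. D i j) = 1"
    and s: "s \<in> carrier_vec n" "\<And>i. i < n \<Longrightarrow> 0 \<le> s $ i"
    and t: "t \<in> carrier_vec n" "\<And>i. i < n \<Longrightarrow> 0 \<le> t $ i"
  shows "(\<Sum>i<n. \<Sum>j<n. D i j * (s $ i * t $ j)) \<le> lp_norm p s * lp_norm q t"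
  using dual
proof (cases rule: dual_exponents_cases)
  case one_inf
  then show ?thesis using stochastic_Hoelder_one_infinity[OF D row s t(1)] by simp
next
  \<comment> \<open>The case of exponents 1 and \<open>\<infinity>\<close> for the transposed weights.\<close>
  case inf_one
  have "(\<Sum>i<n. \<Sum>j<n. D i j * (s $ i * t $ j)) = (\<Sum>j<n. \<Sum>i<n. D i j * (t $ j * s $ i))"
    by (subst sum.swap) (simp add: mult_ac)
  also have "\<dots> \<le> lp_norm 1 t * lp_norm \<infinity> s"
    using D col t s by (intro stochastic_Hoelder_one_infinity) auto
  finally show ?thesis using inf_one by (simp add: mult.commute)
next
  case (real a b)
  define \<alpha> where "\<alpha> = lp_norm p s" 
  define \<beta> where "\<beta> = lp_norm q t"
  show ?thesis
  proof (cases "(\<exists>i<n. s $ i \<noteq> 0) \<and> (\<exists>j<n. t $ j \<noteq> 0)")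
    case True
    then have pos: "0 < \<alpha>" "0 < \<beta>"
      using lp_norm_pos[of a _ s] lp_norm_pos[of b _ t] real s t by (auto simp: \<alpha>_def \<beta>_def)
    have sum_s: "(\<Sum>i<n. (s $ i / \<alpha>) powr a) = 1"
    proof -
      have "(\<Sum>i<n. (s $ i / \<alpha>) powr a) = (\<Sum>i<n. s $ i powr a) / \<alpha> powr a"
        using s pos by (simp add: powr_divide sum_divide_distrib)
      also have "(\<Sum>i<n. s $ i powr a) = \<alpha> powr a"
        using lp_norm_powr[of a s] real s by (simp add: \<alpha>_def)
      finally show ?thesis using pos by simp
    qed
    have sum_t: "(\<Sum>i<n. (t $ i / \<beta>) powr b) = 1"
    proof -
      have "(\<Sum>i<n. (t $ i / \<beta>) powr b) = (\<Sum>i<n. t $ i powr b) / \<beta> powr b"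
        using t pos by (simp add: powr_divide sum_divide_distrib)
      also have "(\<Sum>i<n. t $ i powr b) = \<beta> powr b"
        using lp_norm_powr[of b t] real t by (simp add: \<beta>_def)
      finally show ?thesis using pos by simp
    qed
    have "(\<Sum>i<n. \<Sum>j<n. D i j * (s $ i * t $ j)) / (\<alpha> * \<beta>)
        = (\<Sum>i<n. \<Sum>j<n. D i j * ((s $ i / \<alpha>) * (t $ j / \<beta>)))"
      by (simp add: sum_divide_distrib)
    also have "\<dots> \<le> (\<Sum>i<n. \<Sum>j<n. D i j * ((s $ i / \<alpha>) powr a / a + (t $ j / \<beta>) powr b / b))"
      using real pos D s t
      by (intro sum_mono mult_left_mono Youngs_inequality divide_nonneg_pos) auto
    also have "\<dots> = (\<Sum>i<n. \<Sum>j<n. D i j * ((s $ i / \<alpha>) powr a / a))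
        + (\<Sum>j<n. \<Sum>i<n. D i j * ((t $ j / \<beta>) powr b / b))"
      by (subst (3) sum.swap) (simp add: distrib_left sum.distrib)
    also have "\<dots> = (\<Sum>i<n. (s $ i / \<alpha>) powr a / a) + (\<Sum>j<n. (t $ j / \<beta>) powr b / b)"
      using row col by (simp add: sum_distrib_right[symmetric] del: times_divide_eq_right)
    also have "\<dots> = 1 / a + 1 / b"
      by (simp only: sum_s sum_t flip: sum_divide_distrib)
    finally show ?thesis using pos real by (simp add: \<alpha>_def \<beta>_def)
  next
    case False
    then have "(\<Sum>i<n. \<Sum>j<n. D i j * (s $ i * t $ j)) = 0"
      by (intro sum.neutral ballI) auto
    then show ?thesis by (simp add: lp_norm_nonneg)
  qed
qed

text \<open>The unweighted inequality is the one with the identity matrix as weights.\<close>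
lemma Hoelder_vec:
  fixes p q :: ereal
  assumes dual: "1 \<le> p" "1 \<le> q" "1 / p + 1 / q = 1"
    and s: "s \<in> carrier_vec n" "\<And>i. i < n \<Longrightarrow> 0 \<le> s $ i"
    and t: "t \<in> carrier_vec n" "\<And>i. i < n \<Longrightarrow> 0 \<le> t $ i"
  shows "t \<bullet> s \<le> lp_norm p s * lp_norm q t"
proof -
  have "(\<Sum>i<n. \<Sum>j<n. (if i = j then 1 else 0) * (s $ i * t $ j)) \<le> lp_norm p s * lp_norm q t"
    by (rule stochastic_Hoelder[OF dual _ _ _ s t]) auto
  moreover have "(\<Sum>i<n. \<Sum>j<n. (if i = j then 1 else 0) * (s $ i * t $ j)) = t \<bullet> s"
    using s t by (simp add: scalar_prod_def atLeast0LessThan if_distrib[of "\<lambda>x. x * _"] mult.commute cong: if_cong)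
  ultimately show ?thesis by simp
qed

text \<open>Equality in Hoelder's inequality alone does not confine \<open>z\<close> to the support of \<open>t\<close>: when \<open>p\<close> is
  infinite, the all-ones vector attains it too. The support condition is what makes \<open>z\<close>, as a vector
  of eigenvalues, blind to the nonnegative eigenvalues of \<open>X\<close> when \<open>t\<close> is the negative part of
  the spectrum.\<close>
definition Hoelder_extremal :: "ereal \<Rightarrow> ereal \<Rightarrow> real vec \<Rightarrow> real vec \<Rightarrow> bool" where
  "Hoelder_extremal p q t z \<longleftrightarrow> z \<in> carrier_vec (dim_vec t) \<and> (\<forall>i<dim_vec t. 0 \<le> z $ i)
     \<and> (\<forall>i<dim_vec t. t $ i = 0 \<longrightarrow> z $ i = 0) \<and> lp_norm p z \<le> 1 \<and> t \<bullet> z = lp_norm q t"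

lemma Hoelder_extremal_zero:
  assumes "\<And>i. i < dim_vec t \<Longrightarrow> t $ i = 0"
  shows "Hoelder_extremal p q t (0\<^sub>v (dim_vec t))"
proof -
  have "lp_norm p (0\<^sub>v (dim_vec t)) = 0" by (rule lp_norm_zero) simp
  moreover have "lp_norm q t = 0" using assms by (rule lp_norm_zero)
  ultimately show ?thesis by (simp add: Hoelder_extremal_def)
qed

text \<open>Equality in Young's inequality forces \<open>z\<^sub>i\<^sup>a\<close> to be proportional to \<open>t\<^sub>i\<^sup>b\<close>, which is
  \<open>z\<^sub>i = (t\<^sub>i / N)\<^sup>b\<^sup>-\<^sup>1\<close> because \<open>(b - 1) a = b\<close>; dividing by the norm \<open>N\<close> of \<open>t\<close> makes \<open>z\<close> a
  unit vector.\<close>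
lemma Hoelder_extremal_powr:
  fixes a b :: real
  assumes ab: "1 < a" "1 < b" "1 / a + 1 / b = 1"
    and t: "\<And>i. i < dim_vec t \<Longrightarrow> 0 \<le> t $ i" and nz: "\<exists>i<dim_vec t. t $ i \<noteq> 0"
  shows "Hoelder_extremal (ereal a) (ereal b) t
    (vec (dim_vec t) (\<lambda>i. (t $ i / lp_norm (ereal b) t) powr (b - 1)))"
proof -
  let ?n = "dim_vec t"
  define N where "N = lp_norm (ereal b) t"
  define z where "z = vec ?n (\<lambda>i. (t $ i / N) powr (b - 1))"
  have N: "0 < N" using nz ab lp_norm_pos[of b] by (auto simp: N_def)
  have Nb: "N powr b = (\<Sum>i<?n. t $ i powr b)"
    using lp_norm_powr[of b t] ab t by (simp add: N_def)
  have zi: "z $ i = (t $ i / N) powr (b - 1)" if "i < ?n" for i using that by (simp add: z_def)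
  have exps: "(b - 1) * a = b" using ab by (simp add: field_simps)
  have "(\<Sum>i<?n. \<bar>z $ i\<bar> powr a) = (\<Sum>i<?n. (t $ i / N) powr b)"
    by (simp add: zi powr_powr exps)
  also have "\<dots> = (\<Sum>i<?n. t $ i powr b) / N powr b"
    using t N by (simp add: powr_divide sum_divide_distrib)
  also have "\<dots> = 1" using N by (simp flip: Nb)
  finally have "lp_norm (ereal a) z = 1" by (simp add: lp_norm_ereal z_def)
  moreover have "t \<bullet> z = N"
  proof -
    have "t \<bullet> z = (\<Sum>i<?n. t $ i * (t $ i / N) powr (b - 1))"
      by (simp add: scalar_prod_def z_def atLeast0LessThan)
    also have "\<dots> = (\<Sum>i<?n. t $ i powr b / N powr (b - 1))"
    proof (intro sum.cong refl)
      fix i assume "i \<in> {..<?n}"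
      then have "0 \<le> t $ i" using t by simp
      then show "t $ i * (t $ i / N) powr (b - 1) = t $ i powr b / N powr (b - 1)"
        using N by (cases "t $ i = 0") (auto simp: powr_divide powr_diff)
    qed
    also have "\<dots> = N powr b / N powr (b - 1)" by (simp add: Nb sum_divide_distrib)
    also have "\<dots> = N" using N by (simp add: powr_diff)
    finally show ?thesis .
  qed
  moreover have "z \<in> carrier_vec ?n" "\<forall>i<?n. 0 \<le> z $ i"
    "\<forall>i<?n. t $ i = 0 \<longrightarrow> z $ i = 0"
    by (simp_all add: z_def)
  ultimately have "Hoelder_extremal (ereal a) (ereal b) t z"
    by (simp add: Hoelder_extremal_def N_def)
  then show ?thesis by (simp only: z_def N_def)
qed

lemma Hoelder_extremal_exists:
  fixes p q :: ereal
  assumes dual: "1 \<le> p" "1 \<le> q" "1 / p + 1 / q = 1"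
    and t: "\<And>i. i < dim_vec t \<Longrightarrow> 0 \<le> t $ i"
  shows "\<exists>z. Hoelder_extremal p q t z"
proof (cases "\<exists>i<dim_vec t. t $ i \<noteq> 0")
  case False
  then show ?thesis using Hoelder_extremal_zero by blast
next
  case nz: True
  let ?n = "dim_vec t"
  from dual show ?thesis
  proof (cases rule: dual_exponents_cases)
    case one_inf
    \<comment> \<open>Put all weight on a largest entry of \<open>t\<close>; it is nonzero, so the support condition holds.\<close>
    let ?V = "(\<lambda>i. \<bar>t $ i\<bar>) ` {..<?n}"
    have max: "lp_norm \<infinity> t = Max (insert 0 ?V)" by (simp add: lp_norm_def)
    have "lp_norm \<infinity> t \<noteq> 0" using nz lp_norm_infinity_upper[of _ t] by force
    moreover have "Max (insert 0 ?V) \<in> insert 0 ?V" by (intro Max_in) auto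
    ultimately obtain k where k: "k < ?n" "lp_norm \<infinity> t = t $ k" using max t by auto
    have "(\<Sum>i<?n. \<bar>unit_vec ?n k $ i\<bar>) = (\<Sum>i<?n. if i = k then 1 else (0::real))"
      using k by (intro sum.cong) auto
    then have "lp_norm 1 (unit_vec ?n k) = 1" using k by (simp add: lp_norm_one)
    moreover have "t $ k \<noteq> 0" using \<open>lp_norm \<infinity> t \<noteq> 0\<close> k by simp
    ultimately have "Hoelder_extremal 1 \<infinity> t (unit_vec ?n k)"
      using k by (auto simp: Hoelder_extremal_def)
    then show ?thesis using one_inf by blast
  next
    case inf_one
    define z where "z = vec ?n (\<lambda>i. if t $ i = 0 then 0 else 1 :: real)"
    have "lp_norm \<infinity> z \<le> 1" by (auto simp: lp_norm_def z_def)
    moreover have "t \<bullet> z = lp_norm 1 t"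
      using t by (auto simp: lp_norm_one scalar_prod_def z_def atLeast0LessThan intro!: sum.cong)
    ultimately have "Hoelder_extremal \<infinity> 1 t z" by (auto simp: Hoelder_extremal_def z_def)
    then show ?thesis using inf_one by blast
  next
    case (real a b)
    then show ?thesis using Hoelder_extremal_powr[OF real(3-5) t nz] by blast
  qed
qed

section \<open>The separation problem\<close>

abbreviation neg_part :: "real vec \<Rightarrow> real vec" where
  "neg_part \<equiv> map_vec (\<lambda>x. max (- x) 0)"

text \<open>In eigenbases of \<open>S\<close> and \<open>X\<close> the inner product is a doubly stochastic average of the products
  \<open>s\<^sub>i d\<^sub>j\<close>. Since \<open>s \<ge> 0\<close>, replacing \<open>d\<close> by the negative of its negative part can only decrease it,
  after which the weighted Hoelder inequality applies.\<close>
lemma frob_inner_lower_bound: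
  fixes p q :: ereal
  assumes dual: "1 \<le> p" "1 \<le> q" "1 / p + 1 / q = 1"
    and Q: "Q \<in> orth_mats n" and d: "d \<in> carrier_vec n" and S: "sep_feasible (lp_norm p) n S"
  shows "- lp_norm q (neg_part d) \<le> frob_inner S (Q * diag_of_vec d * transpose_mat Q)"
proof -
  have psd: "S \<in> psd_mats n" and norm: "lp_norm p (eig_vec S) \<le> 1"
    using S by (auto simp: sep_feasible_def)
  obtain P s where P: "P \<in> orth_mats n" and s: "s \<in> carrier_vec n"
    and S_eq: "S = P * diag_of_vec s * transpose_mat P"
    using sym_mats_spectral[of S n] psd by (auto simp: psd_mats_def)
  have s0: "0 \<le> s $ i" if "i < n" for i
    using psd psd_diagonalized_iff[OF P s] that by (simp add: S_eq)
  have norm_s: "lp_norm p s \<le> 1"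
    using norm lp_norm_cong_mset[OF mset_eig_vec_diagonalized[OF P s]] by (simp add: S_eq)
  let ?M = "transpose_mat P * Q" and ?t = "neg_part d"
  note st = orth_mats_squares_stochastic[OF orth_mats_transpose_mult[OF P Q]]
  have t: "?t \<in> carrier_vec n" "\<And>i. i < n \<Longrightarrow> 0 \<le> ?t $ i" using d by auto
  have "(\<Sum>i<n. \<Sum>j<n. (?M $$ (i, j))\<^sup>2 * (s $ i * ?t $ j)) \<le> lp_norm p s * lp_norm q ?t"
    using st s s0 t by (intro stochastic_Hoelder[OF dual]) auto
  also have "\<dots> \<le> lp_norm q ?t"
    using norm_s by (simp add: lp_norm_nonneg mult_left_le_one_le)
  finally have upper: "(\<Sum>i<n. \<Sum>j<n. (?M $$ (i, j))\<^sup>2 * (s $ i * ?t $ j)) \<le> lp_norm q ?t" .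
  have "- (\<Sum>i<n. \<Sum>j<n. (?M $$ (i, j))\<^sup>2 * (s $ i * ?t $ j))
      = (\<Sum>i<n. \<Sum>j<n. (?M $$ (i, j))\<^sup>2 * (s $ i * - ?t $ j))"
    by (simp add: sum_negf)
  also have "\<dots> \<le> (\<Sum>i<n. \<Sum>j<n. (?M $$ (i, j))\<^sup>2 * (s $ i * d $ j))"
    using s0 d by (intro sum_mono mult_left_mono) auto
  also have "\<dots> = frob_inner S (Q * diag_of_vec d * transpose_mat Q)"
    unfolding S_eq frob_inner_diagonalized[OF P s Q d] ..
  finally show ?thesis using upper by linarith
qed

text \<open>With a common eigenbasis the weights form the identity matrix, and \<open>z\<^sub>i d\<^sub>i\<close> equals minus
  \<open>z\<^sub>i\<close> times the negative part: where \<open>d\<^sub>i \<ge> 0\<close>, both sides vanish by the support condition.\<close>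
lemma Hoelder_extremal_attains_bound:
  assumes Q: "Q \<in> orth_mats n" and d: "d \<in> carrier_vec n"
    and z: "Hoelder_extremal p q (neg_part d) z"
  shows "sep_feasible (lp_norm p) n (Q * diag_of_vec z * transpose_mat Q)"
    and "frob_inner (Q * diag_of_vec z * transpose_mat Q) (Q * diag_of_vec d * transpose_mat Q)
      = - lp_norm q (neg_part d)"
proof -
  have zc: "z \<in> carrier_vec n" and z0: "\<And>i. i < n \<Longrightarrow> 0 \<le> z $ i"
    and supp: "\<And>i. i < n \<Longrightarrow> neg_part d $ i = 0 \<Longrightarrow> z $ i = 0"
    and norm: "lp_norm p z \<le> 1" and att: "neg_part d \<bullet> z = lp_norm q (neg_part d)"
    using z d by (auto simp: Hoelder_extremal_def)
  show "sep_feasible (lp_norm p) n (Q * diag_of_vec z * transpose_mat Q)"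
    using norm z0 lp_norm_cong_mset[OF mset_eig_vec_diagonalized[OF Q zc]]
    by (simp add: sep_feasible_def psd_diagonalized_iff[OF Q zc])
  have "frob_inner (Q * diag_of_vec z * transpose_mat Q) (Q * diag_of_vec d * transpose_mat Q)
      = (\<Sum>i<n. \<Sum>j<n. if i = j then z $ i * d $ j else 0)"
    unfolding frob_inner_diagonalized[OF Q zc Q d] orth_matsD(2)[OF Q]
    by (intro sum.cong refl) auto
  also have "\<dots> = (\<Sum>i<n. - (neg_part d $ i * z $ i))"
    using supp d by (auto intro!: sum.cong simp: max_def split: if_splits)
  also have "\<dots> = - (neg_part d \<bullet> z)"
    using zc by (simp add: scalar_prod_def atLeast0LessThan sum_negf)
  finally show "frob_inner (Q * diag_of_vec z * transpose_mat Q) (Q * diag_of_vec d * transpose_mat Q)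
      = - lp_norm q (neg_part d)" using att by simp
qed

lemma Hoelder_extremal_sep_optimal:
  fixes p q :: ereal
  assumes dual: "1 \<le> p" "1 \<le> q" "1 / p + 1 / q = 1"
    and Q: "Q \<in> orth_mats n" and d: "d \<in> carrier_vec n"
    and z: "Hoelder_extremal p q (neg_part d) z"
  shows "sep_optimal (lp_norm p) n (Q * diag_of_vec d * transpose_mat Q)
    (Q * diag_of_vec z * transpose_mat Q)"
  using frob_inner_lower_bound[OF dual Q d] Hoelder_extremal_attains_bound[OF Q d z]
  unfolding sep_optimal_def is_arg_min_linorder by auto

lemma Hoelder_extremal_gauge_maximizer:
  fixes p q :: ereal
  assumes dual: "1 \<le> p" "1 \<le> q" "1 / p + 1 / q = 1"
    and n: "eig_vec X \<in> carrier_vec n" and z: "Hoelder_extremal p q (eig_neg X) z"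
  shows "gauge_maximizer (lp_norm p) n X z"
proof -
  have t: "eig_neg X \<in> carrier_vec n" "\<And>i. i < n \<Longrightarrow> 0 \<le> eig_neg X $ i"
    using n by (auto simp: eig_neg_def)
  have "eig_neg X \<bullet> y \<le> eig_neg X \<bullet> z"
    if y: "y \<in> carrier_vec n" "\<forall>i<n. 0 \<le> y $ i" "lp_norm p y \<le> 1" for y
  proof -
    have "eig_neg X \<bullet> y \<le> lp_norm p y * lp_norm q (eig_neg X)"
      using y t by (intro Hoelder_vec[OF dual]) auto
    also have "\<dots> \<le> lp_norm q (eig_neg X)"
      using y by (simp add: lp_norm_nonneg mult_left_le_one_le)
    finally show ?thesis using z by (simp add: Hoelder_extremal_def)
  qed
  then show ?thesis
    using z t unfolding gauge_maximizer_def is_arg_max_linorder by (auto simp: Hoelder_extremal_def)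
qed

lemma mset_neg_part:
  assumes "mset (list_of_vec x) = mset (list_of_vec y)"
  shows "mset (list_of_vec (neg_part x)) = mset (list_of_vec (neg_part y))"
proof -
  have "list_of_vec (neg_part v) = map (\<lambda>x. max (- x) 0) (list_of_vec v)" for v
    by (intro nth_equalityI) (auto simp: list_of_vec_index)
  then show ?thesis using assms by simp
qed

theorem proposition4p1:
  fixes p q :: ereal and n :: nat and X :: "real mat"
  assumes p: "1 \<le> p" and q: "1 \<le> q" and dual: "1 / p + 1 / q = 1"
    and X: "X \<in> sym_mats n"
  shows "(\<exists>S. sep_optimal (lp_norm p) n X S)
    \<and> sep_value (lp_norm p) n X = - lp_norm q (eig_neg X)
    \<and> (\<forall>Q \<in> orth_mats n. X = Q * diag_of_vec (eig_vec X) * transpose_mat Q \<longrightarrow>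
         (\<exists>z. gauge_maximizer (lp_norm p) n X z
            \<and> sep_optimal (lp_norm p) n X (Q * diag_of_vec z * transpose_mat Q)))
    \<and> (1 < p \<and> p < \<infinity> \<and> X \<notin> psd_mats n \<longrightarrow>
         (let z = vec n (\<lambda>i. (eig_neg X $ i / lp_norm q (eig_neg X)) powr (real_of_ereal q - 1))
          in gauge_maximizer (lp_norm p) n X z
            \<and> (\<forall>Q \<in> orth_mats n. X = Q * diag_of_vec (eig_vec X) * transpose_mat Q \<longrightarrow>
                 sep_optimal (lp_norm p) n X (Q * diag_of_vec z * transpose_mat Q))))"
proof -
  \<comment> \<open>A diagonalization of unspecified order serves for the existence and value claims; the statements
    about a given \<open>Q\<close> use \<open>eig_vec X\<close> as the diagonal.\<close>
  obtain R d where R: "R \<in> orth_mats n" and d: "d \<in> carrier_vec n"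
    and X_eq: "X = R * diag_of_vec d * transpose_mat R"
    using sym_mats_spectral[OF X] .
  have mset: "mset (list_of_vec (eig_vec X)) = mset (list_of_vec d)"
    unfolding X_eq by (rule mset_eig_vec_diagonalized[OF R d])
  have eig: "eig_vec X \<in> carrier_vec n"
    using dim_vec_cong_mset[OF mset] d by (metis carrier_vecD carrier_vecI)
  have norm: "lp_norm q (neg_part d) = lp_norm q (eig_neg X)"
    unfolding eig_neg_def by (rule lp_norm_cong_mset[OF mset_neg_part[OF mset], symmetric])
  have t: "dim_vec (eig_neg X) = n" "\<And>i. i < n \<Longrightarrow> 0 \<le> eig_neg X $ i"
    using eig by (auto simp: eig_neg_def)
  have opt: "sep_optimal (lp_norm p) n X (Q * diag_of_vec z * transpose_mat Q)"
    if "Q \<in> orth_mats n" "X = Q * diag_of_vec (eig_vec X) * transpose_mat Q"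
      "Hoelder_extremal p q (eig_neg X) z" for Q z
    using Hoelder_extremal_sep_optimal[OF p q dual that(1) eig, of z] that(2,3)
    by (simp add: eig_neg_def)

  obtain y where y: "Hoelder_extremal p q (neg_part d) y"
    using Hoelder_extremal_exists[OF p q dual, of "neg_part d"] by auto
  let ?S = "R * diag_of_vec y * transpose_mat R"
  have ex: "sep_optimal (lp_norm p) n X ?S"
    unfolding X_eq by (rule Hoelder_extremal_sep_optimal[OF p q dual R d y])
  have val: "sep_value (lp_norm p) n X = - lp_norm q (eig_neg X)"
    unfolding sep_value_def
  proof (rule cInf_eq_minimum)
    show "- lp_norm q (eig_neg X) \<in> (\<lambda>S. frob_inner S X) ` {S. sep_feasible (lp_norm p) n S}"
      using Hoelder_extremal_attains_bound[OF R d y] by (auto simp: norm X_eq intro!: image_eqI[of _ _ ?S])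
    show "- lp_norm q (eig_neg X) \<le> v" if "v \<in> (\<lambda>S. frob_inner S X) ` {S. sep_feasible (lp_norm p) n S}" for v
      using that frob_inner_lower_bound[OF p q dual R d] by (auto simp: norm X_eq)
  qed

  obtain z where z: "Hoelder_extremal p q (eig_neg X) z"
    using Hoelder_extremal_exists[OF p q dual, of "eig_neg X"] t by metis

  \<comment> \<open>A symmetric matrix that is not positive semidefinite has a negative eigenvalue, so the norm in the denominator is
    positive.\<close>
  have explicit: "Hoelder_extremal p q (eig_neg X)
      (vec n (\<lambda>i. (eig_neg X $ i / lp_norm q (eig_neg X)) powr (real_of_ereal q - 1)))"
    if fin: "1 < p" "p < \<infinity>" and npsd: "X \<notin> psd_mats n"
  proof -
    obtain a b where ab: "p = ereal a" "q = ereal b" "1 < a" "1 < b" "1 / a + 1 / b = 1"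
      using p q dual fin by (cases rule: dual_exponents_cases) auto
    obtain i where i: "i < n" "d $ i < 0"
      using npsd psd_diagonalized_iff[OF R d] by (auto simp: X_eq not_le)
    then have "d $ i \<in> set_mset (mset (list_of_vec d))"
      using d by (auto simp: set_conv_nth list_of_vec_index intro!: exI[of _ i])
    then have "d $ i \<in> set (list_of_vec (eig_vec X))" using mset by (metis set_mset_mset)
    then obtain j where "j < n" "eig_vec X $ j = d $ i"
      using eig by (auto simp: set_conv_nth list_of_vec_index)
    then have "\<exists>j<dim_vec (eig_neg X). eig_neg X $ j \<noteq> 0"
      using eig i t by (intro exI[of _ j]) (auto simp: eig_neg_def)
    then show ?thesis
      using Hoelder_extremal_powr[OF ab(3-5), of "eig_neg X"] t by (simp add: ab)
  qed
  note max = Hoelder_extremal_gauge_maximizer[OF p q dual eig]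
  show ?thesis
  proof (intro conjI ballI impI)
    show "\<exists>S. sep_optimal (lp_norm p) n X S" using ex by blast
    show "sep_value (lp_norm p) n X = - lp_norm q (eig_neg X)" by (rule val)
    show "\<exists>z. gauge_maximizer (lp_norm p) n X z
        \<and> sep_optimal (lp_norm p) n X (Q * diag_of_vec z * transpose_mat Q)"
      if "Q \<in> orth_mats n" "X = Q * diag_of_vec (eig_vec X) * transpose_mat Q" for Q
      using max[OF z] opt[OF that z] by blast
    assume hyps: "1 < p \<and> p < \<infinity> \<and> X \<notin> psd_mats n"
    then have z': "Hoelder_extremal p q (eig_neg X)
      (vec n (\<lambda>i. (eig_neg X $ i / lp_norm q (eig_neg X)) powr (real_of_ereal q - 1)))"
      using explicit by blast
    show "let z = vec n (\<lambda>i. (eig_neg X $ i / lp_norm q (eig_neg X)) powr (real_of_ereal q - 1))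
        in gauge_maximizer (lp_norm p) n X z
          \<and> (\<forall>Q \<in> orth_mats n. X = Q * diag_of_vec (eig_vec X) * transpose_mat Q \<longrightarrow>
               sep_optimal (lp_norm p) n X (Q * diag_of_vec z * transpose_mat Q))"
      unfolding Let_def using max[OF z'] opt[OF _ _ z'] by blast
  qed
qed

end
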